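(* For all $m_0,m_1\in\mathbb R^n$ and every symmetric positive definite $n\times n$ matrix $\Sigma$, $$D_{\rm WKL}\bigl(\mathcal N(m_0,\Sigma)\,\big\|\,\mathcal N(m_1,\Sigma)\bigr)=\frac12\lVert m_1-m_0\rVert^2,$$ independently of $\Sigma$.
   Context: $\lVert\cdot\rVert$ is the Euclidean norm. Definition of $D_{\rm WKL}$. For $\mu=\mathcal N(m_0,\Sigma_0)$, $\nu=\mathcal N(m_1,\Sigma_1)$ with $\Sigma_0,\Sigma_1\succ0$, there is a unique quadratic function $f(x)=\frac12x^\top Ax+b^\top x$ with $A$ real symmetric and $b\in\mathbb R^n$ whose forward gradient flow $\frac{d}{dt}\varphi_t(x)=\nabla f(\varphi_t(x))=A\varphi_t(x)+b$, $\varphi_0(x)=x$, satisfies $(\varphi_1)_*\mu=\nu$ (push-forward of measures). Explicitly, $A=\log R$ (principal symmetric logarithm) with $R=\Sigma_0^{-1/2}(\Sigma_0^{1/2}\Sigma_1\Sigma_0^{1/2})^{1/2}\Sigma_0^{-1/2}$ (symmetric positive definite square roots), and $b=K_1(A)^{-1}(m_1-Rm_0)$ with $K_1(A)=\int_0^1e^{sA}\,ds$. The Wasserstein KL divergence is $$D_{\rm WKL}(\mu\,\|\,\nu):=\int_{\mathbb R^n}\int_0^1\bigl(f(\varphi_1(x))-f(\varphi_t(x))\bigr)\,dt\,d\mu(x).$$ *)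

theory Defs
  imports "HOL-Analysis.Analysis"
begin

definition pos_def :: "real ^ 'n ^ 'n \<Rightarrow> bool" where
  "pos_def S \<longleftrightarrow> transpose S = S \<and> (\<forall>x. x \<noteq> 0 \<longrightarrow> 0 < x \<bullet> (S *v x))"

(* The nondegenerate normal distribution N(m, S), given by its Lebesgue density;
   meaningful for positive definite S. *)
definition gaussian :: "real ^ 'n \<Rightarrow> real ^ 'n ^ 'n \<Rightarrow> (real ^ 'n) measure" where
  "gaussian m S = density lborel
     (\<lambda>x. ennreal (exp (- ((x - m) \<bullet> (matrix_inv S *v (x - m))) / 2)
                   / sqrt ((2 * pi) ^ CARD('n) * det S)))"

definition quadratic_function :: "(real ^ 'n \<Rightarrow> real) \<Rightarrow> bool" where
  "quadratic_function f \<longleftrightarrow>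
     (\<exists>A b. transpose A = A \<and> f = (\<lambda>x. 1 / 2 * (x \<bullet> (A *v x)) + b \<bullet> x))"

(* The gradient vector field of a quadratic function is affine, so its flow exists for all
   times; requiring the equation for every real t makes phi unique as a total function. *)
definition is_gradient_flow ::
    "(real ^ 'n \<Rightarrow> real) \<Rightarrow> (real \<Rightarrow> real ^ 'n \<Rightarrow> real ^ 'n) \<Rightarrow> bool" where
  "is_gradient_flow f \<phi> \<longleftrightarrow>
     (\<forall>x. \<phi> 0 x = x) \<and>
     (\<forall>x t. \<exists>g. (GDERIV f (\<phi> t x) :> g) \<and> ((\<lambda>s. \<phi> s x) has_vector_derivative g) (at t))"

definition gradient_flow :: "(real ^ 'n \<Rightarrow> real) \<Rightarrow> real \<Rightarrow> real ^ 'n \<Rightarrow> real ^ 'n" where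
  "gradient_flow f = (THE \<phi>. is_gradient_flow f \<phi>)"

definition pushes_forward :: "('a \<Rightarrow> 'b) \<Rightarrow> 'a measure \<Rightarrow> 'b measure \<Rightarrow> bool" where
  "pushes_forward T \<mu> \<nu> \<longleftrightarrow> T \<in> measurable \<mu> \<nu> \<and> distr \<mu> \<nu> T = \<nu>"

definition is_wkl_potential ::
    "(real ^ 'n) measure \<Rightarrow> (real ^ 'n) measure \<Rightarrow> (real ^ 'n \<Rightarrow> real) \<Rightarrow> bool" where
  "is_wkl_potential \<mu> \<nu> f \<longleftrightarrow>
     quadratic_function f \<and> (\<exists>\<phi>. is_gradient_flow f \<phi> \<and> pushes_forward (\<phi> 1) \<mu> \<nu>)"

(* For nondegenerate Gaussians there is exactly one such potential; the operator is
   unspecified on pairs of measures without a unique one. *)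
definition wkl_potential ::
    "(real ^ 'n) measure \<Rightarrow> (real ^ 'n) measure \<Rightarrow> real ^ 'n \<Rightarrow> real" where
  "wkl_potential \<mu> \<nu> = (THE f. is_wkl_potential \<mu> \<nu> f)"

definition D_WKL :: "(real ^ 'n) measure \<Rightarrow> (real ^ 'n) measure \<Rightarrow> real" where
  "D_WKL \<mu> \<nu> =
     (let f = wkl_potential \<mu> \<nu>; \<phi> = gradient_flow f
      in LINT x|\<mu>. (LINT t:{0..1}|lborel. f (\<phi> 1 x) - f (\<phi> t x)))"

end

theory Submission
  imports Defs "HOL-Probability.Distributions"
begin

text \<open>
  The linear function \<open>f x = (m1 - m0) \<bullet> x\<close> has the translations \<open>x \<mapsto> x + t (m1 - m0)\<close> as its
  gradient flow, and these carry \<open>N(m0, S)\<close> to \<open>N(m1, S)\<close> at time 1. Along this flow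
  \<open>f (\<phi> 1 x) - f (\<phi> t x) = (1 - t) \<parallel>m1 - m0\<parallel>\<^sup>2\<close> for every \<open>x\<close>, so averaging over \<open>t\<close> gives
  \<open>1/2 \<parallel>m1 - m0\<parallel>\<^sup>2\<close>, and averaging over the probability measure \<open>N(m0, S)\<close> changes nothing.
  What needs proof is that this \<open>f\<close> is the only quadratic potential transporting \<open>N(m0, S)\<close> to
  \<open>N(m1, S)\<close>, and that the given density has total mass 1.

  Uniqueness (\<open>is_wkl_potential_gaussian_same_covariance\<close>). Let \<open>f\<close> have Hessian \<open>A\<close> and let
  \<open>y' = A y\<close>. As \<open>A\<close> is symmetric, \<open>y 0 \<bullet> \<phi> 1 x\<close> equals \<open>y 1 \<bullet> x\<close> up to a constant, so comparing the
  moment generating functions of the two Gaussians gives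
  \<open>y 0 \<bullet> m1 + 1/2 (y 0 \<bullet> S (y 0)) = y 0 \<bullet> \<phi> 1 m0 + 1/2 (y 1 \<bullet> S (y 1))\<close>.
  Replacing \<open>y\<close> by \<open>-y\<close> separates the odd from the even terms
  (\<open>gradient_flow_gaussian_cumulants\<close>): \<open>\<phi> 1\<close> sends mean to mean, and the form of \<open>S\<close> takes the
  same value at \<open>y 0\<close> and \<open>y 1\<close>. By time shifts that value is the same at all integer times, so
  \<open>\<parallel>y\<parallel>\<^sup>2\<close> is bounded there. But \<open>\<parallel>y\<parallel>\<^sup>2\<close> is a convex function of time, since its second derivative is
  \<open>4 \<parallel>A y\<parallel>\<^sup>2\<close>; hence its derivative \<open>2 (y \<bullet> A y)\<close> vanishes at time 0, whatever \<open>y 0\<close> is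
  (\<open>linear_ode_invariant_form_imp_stationary\<close>). This forces \<open>A = 0\<close>.

  Total mass (\<open>nn_integral_gaussian_exp\<close>). Gram-Schmidt for the inner product given by the inverse
  of \<open>S\<close> produces a linear substitution that turns the exponent into \<open>- \<parallel>x\<parallel>\<^sup>2 / 2\<close>; its determinant
  is \<open>\<plusminus> sqrt (det S)\<close>, and the standard Gaussian integral is a product of one-dimensional ones. The
  substitution rule is proved by factoring the linear map into elementary ones
  (\<open>nn_integral_lborel_linear\<close>).
\<close>

section \<open>Linear substitution in Lebesgue integrals\<close>

lemma nn_integral_lborel_translate:
  fixes g :: "'a::euclidean_space \<Rightarrow> ennreal"
  assumes [measurable]: "g \<in> borel_measurable borel"
  shows "(\<integral>\<^sup>+x. g (a + x) \<partial>lborel) = (\<integral>\<^sup>+x. g x \<partial>lborel)"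
proof -
  have "(\<integral>\<^sup>+x. g x \<partial>lborel) = (\<integral>\<^sup>+x. g x \<partial>distr lborel borel ((+) a))"
    by (simp add: lborel_distr_plus)
  then show ?thesis
    by (simp add: nn_integral_distr)
qed

text \<open>Tonelli for a single coordinate direction.\<close>

lemma nn_integral_lborel_split_coordinate:
  fixes g :: "'a::euclidean_space \<Rightarrow> ennreal"
  assumes [measurable]: "g \<in> borel_measurable borel" and b: "b \<in> Basis"
  shows "(\<integral>\<^sup>+x. g x \<partial>lborel) =
    (\<integral>\<^sup>+f. (\<integral>\<^sup>+s. g ((\<Sum>c\<in>Basis - {b}. f c *\<^sub>R c) + s *\<^sub>R b) \<partial>lborel) \<partial>(\<Pi>\<^sub>M c\<in>Basis - {b}. lborel))"
proof -
  interpret product_sigma_finite "\<lambda>_::'a. lborel :: real measure"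
    by standard
  have ins: "Basis = insert b (Basis - {b})"
    using b by auto
  have [measurable]: "(\<lambda>f. g (\<Sum>c\<in>Basis. f c *\<^sub>R c)) \<in> borel_measurable (\<Pi>\<^sub>M c\<in>Basis. lborel)"
    by measurable
  have "(\<integral>\<^sup>+x. g x \<partial>lborel) = (\<integral>\<^sup>+f. g (\<Sum>c\<in>Basis. f c *\<^sub>R c) \<partial>(\<Pi>\<^sub>M c\<in>Basis. lborel))"
    by (subst lborel_eq) (simp add: nn_integral_distr)
  also have "\<dots> = (\<integral>\<^sup>+f. g (\<Sum>c\<in>Basis. f c *\<^sub>R c) \<partial>(\<Pi>\<^sub>M c\<in>insert b (Basis - {b}). lborel))"
    using ins by simp
  also have "\<dots> = (\<integral>\<^sup>+f. (\<integral>\<^sup>+s. g (\<Sum>c\<in>Basis. (f(b := s)) c *\<^sub>R c) \<partial>lborel) \<partial>(\<Pi>\<^sub>M c\<in>Basis - {b}. lborel))"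
    by (rule product_nn_integral_insert) (use ins in auto)
  also have "\<dots> = (\<integral>\<^sup>+f. (\<integral>\<^sup>+s. g ((\<Sum>c\<in>Basis - {b}. f c *\<^sub>R c) + s *\<^sub>R b) \<partial>lborel) \<partial>(\<Pi>\<^sub>M c\<in>Basis - {b}. lborel))"
    by (intro nn_integral_cong arg_cong[where f=g]) (simp add: sum.remove[OF finite_Basis b] add.commute)
  finally show ?thesis .
qed

text \<open>On every line in direction \<open>b\<close> a shear acts as a translation, because the coordinate
  \<open>x \<bullet> b'\<close> is constant there.\<close>

lemma nn_integral_lborel_shear:
  fixes g :: "'a::euclidean_space \<Rightarrow> ennreal"
  assumes [measurable]: "g \<in> borel_measurable borel"
    and b: "b \<in> Basis" "b' \<in> Basis" "b \<noteq> b'"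
  shows "(\<integral>\<^sup>+x. g (x + (x \<bullet> b') *\<^sub>R b) \<partial>lborel) = (\<integral>\<^sup>+x. g x \<partial>lborel)"
proof -
  have inner: "((\<Sum>c\<in>Basis - {b}. f c *\<^sub>R c) + s *\<^sub>R b) \<bullet> b' = f b'" for f s
  proof -
    have "(\<Sum>c\<in>Basis - {b}. f c *\<^sub>R c) \<bullet> b' = (\<Sum>c\<in>Basis - {b}. if c = b' then f c else 0)"
      unfolding inner_sum_left using b by (intro sum.cong refl) (simp add: inner_Basis)
    also have "\<dots> = f b'"
      using b by simp
    finally show ?thesis
      using b by (simp add: inner_add_left inner_Basis[of b b'])
  qed
  have shift: "(\<integral>\<^sup>+s. g (p + s *\<^sub>R b + k *\<^sub>R b) \<partial>lborel) = (\<integral>\<^sup>+s. g (p + s *\<^sub>R b) \<partial>lborel)" for p k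
    using nn_integral_lborel_translate[of "\<lambda>s. g (p + s *\<^sub>R b)" k]
    by (simp add: algebra_simps)
  show ?thesis
    by (simp add: nn_integral_lborel_split_coordinate[OF _ b(1)] inner shift)
qed

lemma Basis_cart: "(Basis :: (real ^ 'n) set) = range (\<lambda>i. axis i 1)"
  by (auto simp: Basis_vec_def)

lemma inj_axis: "inj (\<lambda>i::'n::finite. axis i (1::real))"
  by (simp add: inj_on_def axis_eq_axis)

lemma prod_Basis_cart: "(\<Prod>b\<in>Basis. F b) = (\<Prod>i\<in>UNIV. F (axis i (1::real) :: real ^ 'n))"
  unfolding Basis_cart by (subst prod.reindex[OF inj_axis]) simp

lemma sum_Basis_cart: "(\<Sum>b\<in>Basis. F b) = (\<Sum>i\<in>UNIV. F (axis i (1::real) :: real ^ 'n))"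
  unfolding Basis_cart by (subst sum.reindex[OF inj_axis]) simp

lemma nn_integral_lborel_swap:
  fixes g :: "real ^ 'n \<Rightarrow> ennreal"
  assumes [measurable]: "g \<in> borel_measurable borel"
  shows "(\<integral>\<^sup>+x. g (\<chi> i. x $ Transposition.transpose m n i) \<partial>lborel) = (\<integral>\<^sup>+x. g x \<partial>lborel)"
proof -
  let ?h = "\<lambda>x::real ^ 'n. \<chi> i. x $ Transposition.transpose m n i"
  have [measurable]: "?h \<in> borel_measurable borel"
    by (intro borel_measurable_continuous_onI continuous_intros)
  have "lborel = distr lborel borel ?h"
  proof (rule lborel_eqI)
    fix l u :: "real ^ 'n"
    assume le: "\<And>b. b \<in> Basis \<Longrightarrow> l \<bullet> b \<le> u \<bullet> b"
    have le': "l $ i \<le> u $ i" for i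
      using le[of "axis i 1"] by (simp add: inner_axis)
    have vimage: "?h -` box l u = box (?h l) (?h u)"
    proof (rule set_eqI)
      fix x :: "real ^ 'n"
      have all: "(\<forall>i. R i) \<longleftrightarrow> (\<forall>i. R (Transposition.transpose m n i))" for R
        by (metis transpose_involutory)
      show "x \<in> ?h -` box l u \<longleftrightarrow> x \<in> box (?h l) (?h u)"
        using all[of "\<lambda>i. l $ i < x $ Transposition.transpose m n i \<and> x $ Transposition.transpose m n i < u $ i"]
        by (simp add: mem_box_cart)
    qed
    have "emeasure (distr lborel borel ?h) (box l u) = emeasure lborel (box (?h l) (?h u))"
      by (simp add: emeasure_distr vimage)
    also have "\<dots> = (\<Prod>b\<in>Basis. (?h u - ?h l) \<bullet> b)"
      using le' by (intro emeasure_lborel_box) (auto simp: Basis_vec_def inner_axis)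
    also have "\<dots> = (\<Prod>b\<in>Basis. (u - l) \<bullet> b)"
      using prod.permute[OF permutes_swap_id[of m UNIV n], where g="\<lambda>i. (u - l) $ i"]
      by (simp add: prod_Basis_cart inner_axis o_def)
    finally show "emeasure (distr lborel borel ?h) (box l u) = (\<Prod>b\<in>Basis. (u - l) \<bullet> b)" .
  qed simp
  then have "(\<integral>\<^sup>+x. g x \<partial>lborel) = (\<integral>\<^sup>+x. g x \<partial>distr lborel borel ?h)"
    by simp
  then show ?thesis
    by (simp add: nn_integral_distr)
qed

lemma nn_integral_lborel_stretch:
  fixes g :: "real ^ 'n \<Rightarrow> ennreal"
  assumes [measurable]: "g \<in> borel_measurable borel" and c: "\<And>i. c i \<noteq> 0"
  shows "(\<integral>\<^sup>+x. g x \<partial>lborel) = ennreal (\<Prod>i\<in>UNIV. \<bar>c i\<bar>) * (\<integral>\<^sup>+x. g (\<chi> i. c i * x $ i) \<partial>lborel)"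
proof -
  let ?h = "\<lambda>x::real ^ 'n. \<chi> i. c i * x $ i"
  \<comment> \<open>The coefficients \<open>c\<close>, reindexed by basis vectors.\<close>
  define d where "d b = c (THE i. b = axis i (1::real))" for b :: "real ^ 'n"
  have d_axis: "d (axis i 1) = c i" for i
    by (simp add: d_def axis_eq_axis)
  have d: "d b \<noteq> 0" if "b \<in> Basis" for b
    using that c by (auto simp: Basis_vec_def d_axis)
  have h: "0 + (\<Sum>b\<in>Basis. (d b * (x \<bullet> b)) *\<^sub>R b) = ?h x" for x :: "real ^ 'n"
    by (simp add: sum_Basis_cart d_axis inner_axis vec_eq_iff)
      (simp add: axis_def if_distrib cong: if_cong)
  have p: "(\<Prod>b\<in>Basis. \<bar>d b\<bar>) = (\<Prod>i\<in>UNIV. \<bar>c i\<bar>)"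
    by (simp add: prod_Basis_cart d_axis)
  have [measurable]: "?h \<in> borel_measurable borel"
    by (intro borel_measurable_continuous_onI continuous_intros)
  have "lborel = density (distr lborel borel ?h) (\<lambda>_. ennreal (\<Prod>i\<in>UNIV. \<bar>c i\<bar>))"
    using lborel_affine_euclidean[of d 0, OF d] unfolding h p by simp
  then have "(\<integral>\<^sup>+x. g x \<partial>lborel) = (\<integral>\<^sup>+x. g x \<partial>density (distr lborel borel ?h) (\<lambda>_. ennreal (\<Prod>i\<in>UNIV. \<bar>c i\<bar>)))"
    by simp
  then show ?thesis
    by (simp add: nn_integral_density nn_integral_distr nn_integral_cmult)
qed

lemma det_shear:
  fixes m n :: "'n::finite"
  assumes "m \<noteq> n"
  shows "det (matrix (\<lambda>x::real^'n. \<chi> i. if i = m then x $ m + x $ n else x $ i)) = 1"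
proof -
  have "matrix (\<lambda>x::real^'n. \<chi> i. if i = m then x $ m + x $ n else x $ i)
      = (\<chi> k. if k = m then row m (mat 1) + 1 *s row n (mat 1) else row k (mat 1))"
    by (auto simp: matrix_def row_def mat_def vec_eq_iff axis_def)
  then show ?thesis
    using det_row_operation[OF assms, of "mat 1 :: real^'n^'n" 1] by (simp only: det_I)
qed

text \<open>Both sides are compatible with composition, so it suffices to treat the elementary maps. A map
  whose image lies in a coordinate hyperplane is singular, and the claim is then vacuous.\<close>

lemma nn_integral_lborel_linear:
  fixes f :: "real ^ 'n \<Rightarrow> real ^ 'n" and g :: "real ^ 'n \<Rightarrow> ennreal"
  assumes "linear f" "det (matrix f) \<noteq> 0" "g \<in> borel_measurable borel"
  shows "(\<integral>\<^sup>+x. g x \<partial>lborel) = ennreal \<bar>det (matrix f)\<bar> * (\<integral>\<^sup>+x. g (f x) \<partial>lborel)"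
proof -
  have "det (matrix f) \<noteq> 0 \<longrightarrow> (\<forall>g\<in>borel_measurable borel.
      (\<integral>\<^sup>+x. g x \<partial>lborel) = ennreal \<bar>det (matrix f)\<bar> * (\<integral>\<^sup>+x. g (f x) \<partial>lborel))"
    (is "?Q f")
    using assms(1)
  proof (rule induct_linear_elementary)
    fix f h :: "real ^ 'n \<Rightarrow> real ^ 'n"
    assume lin: "linear f" "linear h" and Q: "?Q f" "?Q h"
    have det: "det (matrix (f \<circ> h)) = det (matrix f) * det (matrix h)"
      using lin by (simp add: matrix_compose det_mul)
    have [measurable]: "f \<in> borel_measurable borel"
      using lin by (intro borel_measurable_continuous_onI linear_continuous_on) (simp add: linear_linear)
    show "?Q (f \<circ> h)"
    proof (intro impI ballI)
      fix g :: "real ^ 'n \<Rightarrow> ennreal"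
      assume nz: "det (matrix (f \<circ> h)) \<noteq> 0" and [measurable]: "g \<in> borel_measurable borel"
      have "(\<integral>\<^sup>+x. g x \<partial>lborel) = ennreal \<bar>det (matrix f)\<bar> * (\<integral>\<^sup>+x. g (f x) \<partial>lborel)"
        by (intro Q(1)[rule_format]) (use nz det in auto)
      also have "(\<integral>\<^sup>+x. g (f x) \<partial>lborel) = ennreal \<bar>det (matrix h)\<bar> * (\<integral>\<^sup>+x. g (f (h x)) \<partial>lborel)"
        by (intro Q(2)[rule_format]) (use nz det in auto)
      finally show "(\<integral>\<^sup>+x. g x \<partial>lborel) = ennreal \<bar>det (matrix (f \<circ> h))\<bar> * (\<integral>\<^sup>+x. g ((f \<circ> h) x) \<partial>lborel)"
        by (simp add: det abs_mult ennreal_mult mult.assoc)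
    qed
  next
    fix f :: "real ^ 'n \<Rightarrow> real ^ 'n" and i
    assume "linear f" "\<And>x. f x $ i = 0"
    then have "\<not> inj f"
      by (metis (full_types) linear_injective_imp_surjective one_neq_zero surjE vec_component)
    then show "?Q f"
      using det_nz_iff_inj[OF \<open>linear f\<close>] by blast
  next
    fix c :: "'n \<Rightarrow> real"
    have det: "det (matrix (\<lambda>x. \<chi> i. c i * x $ i)) = (\<Prod>i\<in>UNIV. c i)"
      by (simp add: axis_def matrix_def det_diagonal)
    show "?Q (\<lambda>x. \<chi> i. c i * x $ i)"
      unfolding det abs_prod by (intro impI ballI nn_integral_lborel_stretch) auto
  next
    fix m n :: 'n
    let ?h = "\<lambda>x::real ^ 'n. \<chi> i. x $ Transposition.transpose m n i"
    have "matrix ?h = transpose (\<chi> i j. mat 1 $ i $ Transposition.transpose m n j)"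
      by (auto simp: vec_eq_iff transpose_def axis_def mat_def matrix_def)
    then have "\<bar>det (matrix ?h)\<bar> = 1"
      by (simp add: det_permute_columns permutes_swap_id sign_swap_id abs_mult)
    then show "?Q ?h"
      by (simp add: nn_integral_lborel_swap)
  next
    fix m n :: 'n
    assume "m \<noteq> n"
    have h: "(\<chi> i. if i = m then x $ m + x $ n else x $ i) = x + (x \<bullet> axis n 1) *\<^sub>R axis m 1"
      for x :: "real ^ 'n"
      by (simp add: vec_eq_iff inner_axis) (simp add: axis_def)
    have det: "det (matrix (\<lambda>x::real^'n. x + (x \<bullet> axis n 1) *\<^sub>R axis m 1)) = 1"
      using det_shear[OF \<open>m \<noteq> n\<close>] by (simp only: h)
    show "?Q (\<lambda>x. \<chi> i. if i = m then x $ m + x $ n else x $ i)"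
      unfolding h det using \<open>m \<noteq> n\<close>
      by (simp add: nn_integral_lborel_shear axis_eq_axis)
  qed
  then show ?thesis
    using assms by blast
qed

section \<open>Positive definite matrices and Gaussian integrals\<close>

lemma symmetric_matrix_inner:
  fixes A :: "real ^ 'n ^ 'n"
  assumes "transpose A = A"
  shows "(A *v x) \<bullet> y = x \<bullet> (A *v y)"
  by (metis assms dot_lmul_matrix transpose_matrix_vector)

lemma borel_measurable_matrix_vector_mult [measurable (raw)]:
  fixes A :: "real ^ 'n ^ 'm"
  assumes "f \<in> borel_measurable N"
  shows "(\<lambda>x. A *v f x) \<in> borel_measurable N"
  using assms
  by (rule measurable_compose)
    (intro borel_measurable_continuous_onI linear_continuous_on matrix_vector_mul_bounded_linear)

lemma pos_def_invertible:
  assumes "pos_def S"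
  shows "S ** matrix_inv S = mat 1" "matrix_inv S ** S = mat 1"
proof -
  have "x = 0" if "S *v x = 0" for x
    using assms that by (metis inner_zero_right order_less_irrefl pos_def_def)
  then have "invertible S"
    by (simp add: invertible_left_inverse matrix_left_invertible_ker)
  then have "S ** matrix_inv S = mat 1 \<and> matrix_inv S ** S = mat 1"
    unfolding invertible_def matrix_inv_def by (rule someI_ex)
  then show "S ** matrix_inv S = mat 1" "matrix_inv S ** S = mat 1"
    by auto
qed

lemma pos_def_inverse:
  assumes "pos_def S"
  shows "pos_def (matrix_inv S)"
proof -
  note inv = pos_def_invertible[OF assms]
  have sym: "transpose S = S"
    using assms by (simp add: pos_def_def)
  have "transpose (matrix_inv S) ** S = mat 1"
    by (metis inv(1) matrix_transpose_mul sym transpose_mat)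
  then have "transpose (matrix_inv S) ** S ** matrix_inv S = matrix_inv S"
    by simp
  then have "transpose (matrix_inv S) = matrix_inv S"
    by (simp add: inv flip: matrix_mul_assoc)
  moreover have "0 < x \<bullet> (matrix_inv S *v x)" if "x \<noteq> 0" for x
  proof -
    define y where "y = matrix_inv S *v x"
    have x: "x = S *v y"
      by (simp add: y_def matrix_vector_mul_assoc inv)
    then have "y \<noteq> 0"
      using that by auto
    then have "0 < y \<bullet> (S *v y)"
      using assms by (simp add: pos_def_def)
    then show ?thesis
      by (metis x y_def inner_commute)
  qed
  ultimately show ?thesis
    by (simp add: pos_def_def)
qed

text \<open>Gram-Schmidt: if fewer than \<open>CARD('n)\<close> vectors have been chosen, some nonzero vector is
  perpendicular to their images under \<open>P\<close>.\<close>

lemma pos_def_orthonormal_family: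
  fixes P :: "real ^ 'n ^ 'n" and I :: "'n set"
  assumes "pos_def P"
  shows "\<exists>v. \<forall>i\<in>I. \<forall>j\<in>I. v i \<bullet> (P *v v j) = of_bool (i = j)"
proof (induction I rule: finite_induct[OF finite])
  case 1
  then show ?case by simp
next
  case (2 k I)
  then obtain v where v: "\<And>i j. i \<in> I \<Longrightarrow> j \<in> I \<Longrightarrow> v i \<bullet> (P *v v j) = of_bool (i = j)"
    by blast
  have sym: "(P *v x) \<bullet> y = x \<bullet> (P *v y)" for x y
    using assms by (simp add: pos_def_def symmetric_matrix_inner)
  have "dim ((\<lambda>i. P *v v i) ` I) \<le> card I"
    by (rule order_trans[OF dim_le_card' card_image_le]) auto
  also have "card I < card (UNIV :: 'n set)"
    using \<open>k \<notin> I\<close> by (intro psubset_card_mono) auto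
  finally have "dim ((\<lambda>i. P *v v i) ` I) < DIM(real ^ 'n)"
    by simp
  then obtain x where "x \<noteq> 0" and x: "\<And>y. y \<in> span ((\<lambda>i. P *v v i) ` I) \<Longrightarrow> orthogonal x y"
    by (rule orthogonal_to_subspace_exists) blast
  have perp: "x \<bullet> (P *v v i) = 0" "v i \<bullet> (P *v x) = 0" if "i \<in> I" for i
  proof -
    show "x \<bullet> (P *v v i) = 0"
      using x[OF span_base, of "P *v v i"] that by (auto simp: orthogonal_def)
    then show "v i \<bullet> (P *v x) = 0"
      using sym[of "v i" x] by (simp add: inner_commute)
  qed
  define q where "q = x \<bullet> (P *v x)"
  have "q > 0"
    using assms \<open>x \<noteq> 0\<close> by (simp add: pos_def_def q_def)
  define w where "w = v(k := (1 / sqrt q) *\<^sub>R x)"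
  have wk: "w k = (1 / sqrt q) *\<^sub>R x" and wI: "i \<in> I \<Longrightarrow> w i = v i" for i
    using \<open>k \<notin> I\<close> by (auto simp: w_def)
  have "w k \<bullet> (P *v w k) = 1"
    using \<open>q > 0\<close> by (simp add: wk matrix_vector_mult_scaleR flip: q_def)
  moreover have "w k \<bullet> (P *v w i) = 0" "w i \<bullet> (P *v w k) = 0" if "i \<in> I" for i
    using perp[OF that] by (simp_all add: wk wI[OF that] matrix_vector_mult_scaleR)
  moreover have "w i \<bullet> (P *v w j) = of_bool (i = j)" if "i \<in> I" "j \<in> I" for i j
    using v that by (simp add: wI)
  ultimately have "\<forall>i\<in>insert k I. \<forall>j\<in>insert k I. w i \<bullet> (P *v w j) = of_bool (i = j)"
    using \<open>k \<notin> I\<close> by auto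
  then show ?case
    by blast
qed

lemma pos_def_congruent_identity:
  fixes P :: "real ^ 'n ^ 'n"
  assumes "pos_def P"
  obtains M :: "real ^ 'n ^ 'n" where "transpose M ** P ** M = mat 1"
proof -
  obtain v :: "'n \<Rightarrow> real ^ 'n" where v: "\<And>i j. v i \<bullet> (P *v v j) = of_bool (i = j)"
    using pos_def_orthonormal_family[OF assms, of UNIV] by blast
  define M :: "real ^ 'n ^ 'n" where "M = (\<chi> a i. v i $ a)"
  have "(transpose M ** P ** M) $ i $ j = v i \<bullet> (P *v v j)" for i j
    unfolding matrix_mul_assoc[symmetric]
    by (simp add: matrix_matrix_mult_def matrix_vector_mult_def transpose_def M_def inner_vec_def)
  then have "transpose M ** P ** M = mat 1"
    by (simp add: vec_eq_iff v mat_def)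
  then show thesis
    by (rule that)
qed

lemma nn_integral_std_gaussian:
  "(\<integral>\<^sup>+x. ennreal (exp (- (x \<bullet> x) / 2)) \<partial>(lborel :: (real ^ 'n) measure)) = ennreal (sqrt ((2 * pi) ^ CARD('n)))"
proof -
  have one: "(\<integral>\<^sup>+x. ennreal (exp (- x\<^sup>2 / 2)) \<partial>lborel) = ennreal (sqrt (2 * pi))"
  proof -
    have "(\<integral>\<^sup>+x. ennreal (std_normal_density x) \<partial>lborel) = 1"
      using prob_space.emeasure_space_1[OF prob_space_normal_density[of 1 0]]
      by (simp add: emeasure_density)
    then have "ennreal (sqrt (2 * pi)) * (\<integral>\<^sup>+x. ennreal (std_normal_density x) \<partial>lborel) = ennreal (sqrt (2 * pi))"
      by simp
    then show ?thesis
      by (simp add: std_normal_density_def nn_integral_cmult[symmetric] ennreal_mult[symmetric])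
  qed
  have "ennreal (exp (- (x \<bullet> x) / 2)) = (\<Prod>b\<in>Basis. ennreal (exp (- (x \<bullet> b)\<^sup>2 / 2)))" for x :: "real ^ 'n"
  proof -
    have "- (x \<bullet> x) / 2 = (\<Sum>b\<in>Basis. - (x \<bullet> b)\<^sup>2 / 2)"
      by (subst euclidean_inner) (simp add: power2_eq_square sum_negf sum_divide_distrib)
    then show ?thesis
      by (simp add: exp_sum prod_ennreal)
  qed
  then have "(\<integral>\<^sup>+x. ennreal (exp (- (x \<bullet> x) / 2)) \<partial>(lborel :: (real ^ 'n) measure))
      = (\<Prod>b\<in>(Basis :: (real ^ 'n) set). \<integral>\<^sup>+x. ennreal (exp (- x\<^sup>2 / 2)) \<partial>lborel)"
    using nn_integral_lborel_prod[of "\<lambda>(_ :: real ^ 'n) x. ennreal (exp (- x\<^sup>2 / 2))"] by simp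
  then show ?thesis
    using one by (simp add: ennreal_power real_sqrt_power real_sqrt_mult power_mult_distrib)
qed

text \<open>Substitute \<open>x = M y\<close>, where \<open>M\<close> turns the quadratic form of the inverse of \<open>S\<close> into the
  Euclidean one. Taking determinants in \<open>M\<^sup>T S\<^sup>-\<^sup>1 M = I\<close> gives \<open>det S = (det M)\<^sup>2\<close>, which yields both
  the positivity and the constant.\<close>

lemma nn_integral_gaussian_exp:
  fixes S :: "real ^ 'n ^ 'n"
  assumes "pos_def S"
  shows "det S > 0"
    and "(\<integral>\<^sup>+x. ennreal (exp (- (x \<bullet> (matrix_inv S *v x)) / 2)) \<partial>lborel)
      = ennreal (sqrt ((2 * pi) ^ CARD('n) * det S))"
proof -
  obtain M :: "real ^ 'n ^ 'n" where M: "transpose M ** matrix_inv S ** M = mat 1"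
    using pos_def_congruent_identity[OF pos_def_inverse[OF assms]] .
  have "det (transpose M ** matrix_inv S ** M) = 1" "det (S ** matrix_inv S) = 1"
    by (simp_all add: M pos_def_invertible[OF assms] del: det_transpose)
  then have d: "(det M)\<^sup>2 * det (matrix_inv S) = 1" "det S * det (matrix_inv S) = 1"
    by (simp_all add: det_mul power2_eq_square mult_ac)
  then have detS: "det S = (det M)\<^sup>2"
    by (metis mult_cancel_right zero_neq_one mult_zero_right)
  have nz: "det M \<noteq> 0"
    using d(1) by auto
  show "det S > 0"
    using nz by (simp add: detS)
  have lin: "linear ((*v) M)"
    by (rule matrix_vector_mul_linear)
  have q: "(M *v x) \<bullet> (matrix_inv S *v (M *v x)) = x \<bullet> x" for x
  proof -
    have "(M *v x) \<bullet> (matrix_inv S *v (M *v x)) = x \<bullet> ((transpose M ** matrix_inv S ** M) *v x)"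
      unfolding matrix_vector_mul_assoc[symmetric]
      by (subst inner_commute) (simp only: inner_commute[of x] transpose_matrix_vector dot_lmul_matrix)
    then show ?thesis
      by (simp add: M)
  qed
  have meas: "(\<lambda>x. ennreal (exp (- (x \<bullet> (matrix_inv S *v x)) / 2))) \<in> borel_measurable borel"
    by measurable
  have "(\<integral>\<^sup>+x. ennreal (exp (- (x \<bullet> (matrix_inv S *v x)) / 2)) \<partial>lborel)
      = ennreal \<bar>det M\<bar> * (\<integral>\<^sup>+x. ennreal (exp (- (x \<bullet> x) / 2)) \<partial>(lborel :: (real ^ 'n) measure))"
    using nn_integral_lborel_linear[OF lin _ meas] nz by (simp add: q)
  also have "\<dots> = ennreal (sqrt ((2 * pi) ^ CARD('n) * det S))"
    unfolding nn_integral_std_gaussian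
    by (simp add: ennreal_mult[symmetric] detS real_sqrt_mult mult.commute)
  finally show "(\<integral>\<^sup>+x. ennreal (exp (- (x \<bullet> (matrix_inv S *v x)) / 2)) \<partial>lborel)
      = ennreal (sqrt ((2 * pi) ^ CARD('n) * det S))" .
qed

lemma sets_gaussian [simp, measurable_cong]: "sets (gaussian m S) = sets borel"
  by (simp add: gaussian_def)

lemma space_gaussian [simp]: "space (gaussian m S) = UNIV"
  by (simp add: gaussian_def)

lemma nn_integral_gaussian:
  fixes S :: "real ^ 'n ^ 'n"
  assumes [measurable]: "g \<in> borel_measurable borel"
  shows "(\<integral>\<^sup>+x. g x \<partial>gaussian m S) = (\<integral>\<^sup>+x. ennreal (exp (- (x \<bullet> (matrix_inv S *v x)) / 2)
      / sqrt ((2 * pi) ^ CARD('n) * det S)) * g (m + x) \<partial>lborel)"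
proof -
  have "(\<integral>\<^sup>+x. g x \<partial>gaussian m S) = (\<integral>\<^sup>+x. ennreal (exp (- ((x - m) \<bullet> (matrix_inv S *v (x - m))) / 2)
      / sqrt ((2 * pi) ^ CARD('n) * det S)) * g x \<partial>lborel)"
    unfolding gaussian_def by (intro nn_integral_density) measurable
  then show ?thesis
    using nn_integral_lborel_translate[of "\<lambda>x. ennreal (exp (- ((x - m) \<bullet> (matrix_inv S *v (x - m))) / 2)
      / sqrt ((2 * pi) ^ CARD('n) * det S)) * g x" m] by (simp del: power_mult_distrib)
qed

text \<open>Completing the square: shifting the integration variable by \<open>S v\<close> absorbs the linear term
  \<open>v \<bullet> x\<close> of the exponent and leaves the factor \<open>exp (v \<bullet> S v / 2)\<close>. For \<open>v = 0\<close> this says that the total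
  mass is 1.\<close>

lemma gaussian_moment_generating_function:
  fixes S :: "real ^ 'n ^ 'n"
  assumes "pos_def S"
  shows "(\<integral>\<^sup>+x. ennreal (exp (v \<bullet> x)) \<partial>gaussian m S) = ennreal (exp (v \<bullet> m + v \<bullet> (S *v v) / 2))"
proof -
  define C where "C = sqrt ((2 * pi) ^ CARD('n) * det S)"
  define P where "P = matrix_inv S"
  have "C > 0"
    using nn_integral_gaussian_exp(1)[OF assms] by (simp add: C_def)
  have symS: "(S *v x) \<bullet> y = x \<bullet> (S *v y)" and symP: "(P *v x) \<bullet> y = x \<bullet> (P *v y)" for x y
    using assms pos_def_inverse[OF assms] by (auto simp: pos_def_def P_def intro!: symmetric_matrix_inner)
  have PS: "P *v (S *v x) = x" for x
    by (simp add: matrix_vector_mul_assoc P_def pos_def_invertible[OF assms])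
  have square: "- ((S *v v + x) \<bullet> (P *v (S *v v + x))) / 2 + v \<bullet> (S *v v + x)
      = v \<bullet> (S *v v) / 2 + - (x \<bullet> (P *v x)) / 2" for x
  proof -
    have "(S *v v) \<bullet> (P *v x) = v \<bullet> x"
      by (metis PS symP)
    then show ?thesis
      by (simp add: matrix_vector_right_distrib PS inner_add_left inner_add_right field_simps inner_commute)
  qed
  have "(\<integral>\<^sup>+x. ennreal (exp (v \<bullet> x)) \<partial>gaussian m S)
      = (\<integral>\<^sup>+x. ennreal (exp (- (x \<bullet> (P *v x)) / 2) / C) * ennreal (exp (v \<bullet> (m + x))) \<partial>lborel)"
    unfolding P_def C_def by (intro nn_integral_gaussian) measurable
  also have "\<dots> = (\<integral>\<^sup>+x. ennreal (exp (v \<bullet> m) / C) * ennreal (exp (- (x \<bullet> (P *v x)) / 2 + v \<bullet> x)) \<partial>lborel)"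
    using \<open>C > 0\<close> by (intro nn_integral_cong) (simp add: ennreal_mult[symmetric] inner_add_right exp_add[symmetric] algebra_simps)
  also have "\<dots> = (\<integral>\<^sup>+x. ennreal (exp (v \<bullet> m) / C) * ennreal (exp (v \<bullet> (S *v v) / 2 + - (x \<bullet> (P *v x)) / 2)) \<partial>lborel)"
    (is "?l = _")
  proof -
    have "?l = (\<integral>\<^sup>+x. ennreal (exp (v \<bullet> m) / C) * ennreal (exp (- ((S *v v + x) \<bullet> (P *v (S *v v + x))) / 2 + v \<bullet> (S *v v + x))) \<partial>lborel)"
      by (rule nn_integral_lborel_translate[symmetric]) measurable
    then show ?thesis
      by (simp only: square)
  qed
  also have "\<dots> = (\<integral>\<^sup>+x. ennreal (exp (v \<bullet> m + v \<bullet> (S *v v) / 2) / C) * ennreal (exp (- (x \<bullet> (P *v x)) / 2)) \<partial>lborel)"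
    using \<open>C > 0\<close> by (intro nn_integral_cong) (simp add: ennreal_mult[symmetric] exp_add[symmetric] algebra_simps)
  also have "\<dots> = ennreal (exp (v \<bullet> m + v \<bullet> (S *v v) / 2) / C) * ennreal C"
  proof -
    show ?thesis
      using nn_integral_gaussian_exp(2)[OF assms] by (simp add: nn_integral_cmult P_def C_def)
  qed
  also have "\<dots> = ennreal (exp (v \<bullet> m + v \<bullet> (S *v v) / 2))"
    using \<open>C > 0\<close> by (simp add: ennreal_mult[symmetric])
  finally show ?thesis .
qed

lemma gaussian_translate:
  fixes S :: "real ^ 'n ^ 'n"
  shows
  "pushes_forward (\<lambda>x. x + a) (gaussian m S) (gaussian (m + a) S)"
proof -
  have "distr (gaussian m S) (gaussian (m + a) S) (\<lambda>x. x + a) = gaussian (m + a) S"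
  proof (rule measure_eqI)
    fix A
    assume "A \<in> sets (distr (gaussian m S) (gaussian (m + a) S) (\<lambda>x. x + a))"
    then have A [measurable]: "A \<in> sets borel"
      by simp
    have vA: "(\<lambda>x. x + a) -` A \<in> sets borel"
      using measurable_sets[of "\<lambda>x. x + a" borel borel A] by simp
    have "emeasure (distr (gaussian m S) (gaussian (m + a) S) (\<lambda>x. x + a)) A
        = (\<integral>\<^sup>+x. indicator ((\<lambda>x. x + a) -` A) x \<partial>gaussian m S)"
      using vA by (simp add: emeasure_distr)
    also have "\<dots> = (\<integral>\<^sup>+x. indicator A x \<partial>gaussian (m + a) S)"
      using vA by (simp add: nn_integral_gaussian indicator_vimage add_ac del: nn_integral_indicator)
    also have "\<dots> = emeasure (gaussian (m + a) S) A"
      by simp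
    finally show "emeasure (distr (gaussian m S) (gaussian (m + a) S) (\<lambda>x. x + a)) A = emeasure (gaussian (m + a) S) A" .
  qed simp
  then show ?thesis
    by (simp add: pushes_forward_def)
qed

section \<open>Gradient flows of quadratic functions\<close>

lemma GDERIV_unique:
  assumes "GDERIV f x :> g" "GDERIV f x :> g'"
  shows "g = g'"
proof -
  have "(\<lambda>h. h \<bullet> g) = (\<lambda>h. h \<bullet> g')"
    using assms unfolding gderiv_def by (rule has_derivative_unique)
  then show ?thesis
    using vector_eq_ldot[of g g'] by (simp add: fun_eq_iff)
qed

lemma GDERIV_quadratic:
  fixes A :: "real ^ 'n ^ 'n"
  assumes "transpose A = A"
  shows "GDERIV (\<lambda>x. 1 / 2 * (x \<bullet> (A *v x)) + b \<bullet> x) x :> A *v x + b"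
proof -
  have "((\<lambda>x. A *v x) has_derivative (\<lambda>h. A *v h)) (at x)"
    by (rule bounded_linear_imp_has_derivative[OF matrix_vector_mul_bounded_linear])
  then have "((\<lambda>x. 1 / 2 * (x \<bullet> (A *v x)) + b \<bullet> x) has_derivative
      (\<lambda>h. 1 / 2 * (x \<bullet> (A *v h) + h \<bullet> (A *v x)) + b \<bullet> h)) (at x)"
    by (intro has_derivative_add has_derivative_mult_right has_derivative_inner
        has_derivative_inner_right has_derivative_ident)
  moreover have "x \<bullet> (A *v h) = h \<bullet> (A *v x)" for h
    by (metis symmetric_matrix_inner[OF assms] inner_commute)
  ultimately show ?thesis
    by (simp add: gderiv_def inner_add_right inner_commute[of b])
qed

lemma is_gradient_flow_quadratic_iff:
  fixes A :: "real ^ 'n ^ 'n"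
  assumes "transpose A = A"
  shows "is_gradient_flow (\<lambda>x. 1 / 2 * (x \<bullet> (A *v x)) + b \<bullet> x) \<phi> \<longleftrightarrow>
    (\<forall>x. \<phi> 0 x = x) \<and> (\<forall>x t. ((\<lambda>s. \<phi> s x) has_vector_derivative (A *v \<phi> t x + b)) (at t))"
proof -
  have "GDERIV (\<lambda>x. 1 / 2 * (x \<bullet> (A *v x)) + b \<bullet> x) p :> g \<longleftrightarrow> g = A *v p + b" for p g
    using GDERIV_quadratic[OF assms, of b p] GDERIV_unique by blast
  then show ?thesis
    by (simp add: is_gradient_flow_def)
qed

lemma transpose_0 [simp]: "transpose (0 :: real ^ 'n ^ 'n) = 0"
  by (simp add: transpose_def vec_eq_iff)

lemma is_gradient_flow_linear_iff:
  fixes b :: "real ^ 'n"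
  shows "is_gradient_flow (\<lambda>x. b \<bullet> x) \<phi> \<longleftrightarrow> \<phi> = (\<lambda>t x. x + t *\<^sub>R b)"
proof -
  have "is_gradient_flow (\<lambda>x. b \<bullet> x) \<phi> \<longleftrightarrow>
      (\<forall>x. \<phi> 0 x = x) \<and> (\<forall>x t. ((\<lambda>s. \<phi> s x) has_vector_derivative b) (at t))"
    using is_gradient_flow_quadratic_iff[of "0 :: real ^ 'n ^ 'n" b \<phi>] by simp
  also have "\<dots> \<longleftrightarrow> \<phi> = (\<lambda>t x. x + t *\<^sub>R b)"
  proof safe
    assume 0: "\<forall>x. \<phi> 0 x = x" and d: "\<forall>x t. ((\<lambda>s. \<phi> s x) has_vector_derivative b) (at t)"
    have "\<phi> t x - t *\<^sub>R b = \<phi> 0 x - 0 *\<^sub>R b" for t x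
    proof -
      have "((\<lambda>s. \<phi> s x - s *\<^sub>R b) has_vector_derivative 0) (at s)" for s
        using d by (auto intro!: derivative_eq_intros)
      then show ?thesis
        using has_vector_derivative_zero_constant[of UNIV "\<lambda>s. \<phi> s x - s *\<^sub>R b"] by (metis (lifting) UNIV_I convex_UNIV)
    qed
    then show "\<phi> = (\<lambda>t x. x + t *\<^sub>R b)"
      using 0 by (simp add: fun_eq_iff algebra_simps)
  next
    fix x t
    show "((\<lambda>s. x + s *\<^sub>R b) has_vector_derivative b) (at t)"
      by (auto intro!: derivative_eq_intros)
  qed auto
  finally show ?thesis .
qed

section \<open>Linear differential equations with symmetric matrix\<close>

definition solves_linear_ode :: "real ^ 'n ^ 'n \<Rightarrow> (real \<Rightarrow> real ^ 'n) \<Rightarrow> bool" where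
  "solves_linear_ode A y \<longleftrightarrow> (\<forall>t. (y has_vector_derivative (A *v y t)) (at t))"

lemma solves_linear_odeD:
  "solves_linear_ode A y \<Longrightarrow> (y has_derivative (\<lambda>h. h *\<^sub>R (A *v y t))) (at t)"
  by (simp add: solves_linear_ode_def has_vector_derivative_def)

lemma solves_linear_ode_uminus:
  fixes A :: "real ^ 'n ^ 'n"
  shows "solves_linear_ode A y \<Longrightarrow> solves_linear_ode A (\<lambda>t. - y t)"
  unfolding solves_linear_ode_def
  by (auto intro!: derivative_eq_intros simp: linear_neg[OF matrix_vector_mul_linear])

lemma solves_linear_ode_shift:
  assumes "solves_linear_ode A y"
  shows "solves_linear_ode A (\<lambda>t. y (t + c))"
proof -
  have "((\<lambda>t. y (t + c)) has_derivative (\<lambda>h. h *\<^sub>R (A *v y (t + c)))) (at t)" for t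
    by (rule has_derivative_compose[where g=y, OF _ solves_linear_odeD[OF assms], of "\<lambda>t. t + c" "\<lambda>h. h"])
      (auto intro!: derivative_eq_intros)
  then show ?thesis
    by (simp add: solves_linear_ode_def has_vector_derivative_def)
qed

text \<open>This is the symmetry of \<open>exp A\<close>: \<open>z t \<bullet> y (1 - t)\<close> has
  derivative \<open>A z \<bullet> y - z \<bullet> A y = 0\<close>.\<close>

lemma solves_linear_ode_pairing:
  fixes A :: "real ^ 'n ^ 'n"
  assumes sym: "transpose A = A" and y: "solves_linear_ode A y" and z: "solves_linear_ode A z"
  shows "z 1 \<bullet> y 0 = z 0 \<bullet> y 1"
proof -
  have y': "((\<lambda>t. y (1 - t)) has_derivative (\<lambda>h. - h *\<^sub>R (A *v y (1 - t)))) (at t)" for t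
    by (rule has_derivative_compose[where g=y, OF _ solves_linear_odeD[OF y], of "\<lambda>t. 1 - t" "\<lambda>h. - h"])
      (auto intro!: derivative_eq_intros)
  have "((\<lambda>t. z t \<bullet> y (1 - t)) has_real_derivative 0) (at t)" for t
    unfolding has_field_derivative_def
    by (rule has_derivative_eq_rhs[OF has_derivative_inner[OF solves_linear_odeD[OF z] y']])
      (simp add: symmetric_matrix_inner[OF sym] fun_eq_iff)
  then have "z 1 \<bullet> y (1 - 1) = z 0 \<bullet> y (1 - 0)"
    using DERIV_isconst_all[of "\<lambda>t. z t \<bullet> y (1 - t)" 1 0] by blast
  then show ?thesis
    by simp
qed

text \<open>The function \<open>\<parallel>y\<parallel>\<^sup>2\<close> is convex in time, its second derivative being \<open>4 \<parallel>A y\<parallel>\<^sup>2\<close>, and so it lies above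
  its tangent at time 0.\<close>

lemma solves_linear_ode_norm_tangent:
  fixes A :: "real ^ 'n ^ 'n"
  assumes sym: "transpose A = A" and y: "solves_linear_ode A y"
  shows "y 0 \<bullet> y 0 + 2 * (y 0 \<bullet> (A *v y 0)) * t \<le> y t \<bullet> y t"
proof -
  note y' = solves_linear_odeD[OF y]
  have Ay': "((\<lambda>t. A *v y t) has_derivative (\<lambda>h. A *v (h *\<^sub>R (A *v y t)))) (at t)" for t
    by (rule bounded_linear.has_derivative[OF matrix_vector_mul_bounded_linear y'])
  have d1: "((\<lambda>t. y t \<bullet> y t) has_real_derivative 2 * (y t \<bullet> (A *v y t))) (at t)" for t
    unfolding has_field_derivative_def
    by (rule has_derivative_eq_rhs[OF has_derivative_inner[OF y' y']])
      (simp add: inner_commute fun_eq_iff)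
  have d2: "((\<lambda>t. 2 * (y t \<bullet> (A *v y t))) has_real_derivative 4 * ((A *v y t) \<bullet> (A *v y t))) (at t)" for t
    unfolding has_field_derivative_def
    by (rule has_derivative_eq_rhs[OF has_derivative_mult_right[OF has_derivative_inner[OF y' Ay']]])
      (simp add: symmetric_matrix_inner[OF sym] matrix_vector_mult_scaleR fun_eq_iff)
  have "convex_on UNIV (\<lambda>t. y t \<bullet> y t)"
    by (rule f''_ge0_imp_convex[OF _ d1 d2]) auto
  then have "2 * (y 0 \<bullet> (A *v y 0)) * (t - 0) \<le> y t \<bullet> y t - y 0 \<bullet> y 0"
    by (rule convex_on_imp_above_tangent) (use d1 in auto)
  then show ?thesis
    by simp
qed

text \<open>The constant is the minimum of the quadratic form on the compact unit sphere.\<close>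

lemma pos_def_coercive:
  fixes S :: "real ^ 'n ^ 'n"
  assumes "pos_def S"
  obtains c where "c > 0" "\<And>w. c * (w \<bullet> w) \<le> w \<bullet> (S *v w)"
proof -
  have "continuous_on (sphere 0 1) (\<lambda>w. w \<bullet> (S *v w))"
    by (intro continuous_intros linear_continuous_on matrix_vector_mul_bounded_linear)
  then have "\<exists>u\<in>sphere 0 1. \<forall>w\<in>sphere 0 1. u \<bullet> (S *v u) \<le> w \<bullet> (S *v w)"
    by (intro continuous_attains_inf) auto
  then obtain u where u: "u \<in> sphere 0 1" "\<And>w. w \<in> sphere 0 1 \<Longrightarrow> u \<bullet> (S *v u) \<le> w \<bullet> (S *v w)"
    by blast
  show thesis
  proof (rule that)
    have "u \<noteq> 0"
      using u(1) by auto
    then show "u \<bullet> (S *v u) > 0"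
      using assms by (simp add: pos_def_def)
    show "u \<bullet> (S *v u) * (w \<bullet> w) \<le> w \<bullet> (S *v w)" for w
    proof (cases "w = 0")
      case False
      have "u \<bullet> (S *v u) \<le> (w /\<^sub>R norm w) \<bullet> (S *v (w /\<^sub>R norm w))"
        using False by (intro u(2)) simp
      then have "u \<bullet> (S *v u) \<le> (w \<bullet> (S *v w)) / (norm w)\<^sup>2"
        by (simp add: matrix_vector_mult_scaleR power2_eq_square field_simps)
      then show ?thesis
        using False by (simp add: pos_le_divide_eq power2_norm_eq_inner)
    qed simp
  qed
qed

lemma nonpos_if_multiples_bounded:
  fixes a C :: real
  assumes "\<And>n::nat. real n * a \<le> C"
  shows "a \<le> 0"
proof (rule ccontr)
  assume "\<not> a \<le> 0"
  then obtain n :: nat where "C < real n * a"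
    using reals_Archimedean3[of a] by auto
  then show False
    using assms[of n] by simp
qed

text \<open>The hypothesis, applied to all time shifts of \<open>y\<close>, makes the form of \<open>S\<close> constant along \<open>y\<close> at
  integer times, and so bounds \<open>\<parallel>y\<parallel>\<^sup>2\<close> there. A tangent of nonzero slope would force \<open>\<parallel>y\<parallel>\<^sup>2\<close> to infinity
  along the positive or the negative integers.\<close>

lemma linear_ode_invariant_form_imp_stationary:
  fixes A S :: "real ^ 'n ^ 'n"
  assumes sym: "transpose A = A" and S: "pos_def S"
    and invariant: "\<And>y. solves_linear_ode A y \<Longrightarrow> y 1 \<bullet> (S *v y 1) = y 0 \<bullet> (S *v y 0)"
    and y: "solves_linear_ode A y"
  shows "y 0 \<bullet> (A *v y 0) = 0"
proof -
  obtain c where c: "c > 0" "\<And>w. c * (w \<bullet> w) \<le> w \<bullet> (S *v w)"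
    using pos_def_coercive[OF S] by blast
  define q where "q t = y t \<bullet> (S *v y t)" for t
  have step: "q (t + 1) = q t" for t
    using invariant[OF solves_linear_ode_shift[OF y, of t]] by (simp add: q_def add.commute)
  have q_nat: "q (real n) = q 0" "q (- real n) = q 0" for n
  proof (induction n)
    case (Suc n)
    show "q (real (Suc n)) = q 0"
      using step[of "real n"] Suc by (simp add: add.commute)
    show "q (- real (Suc n)) = q 0"
      using step[of "- real (Suc n)"] Suc by simp
  qed auto
  define a where "a = 2 * (y 0 \<bullet> (A *v y 0))"
  have bound: "a * t \<le> q 0 / c" if "q t = q 0" for t
  proof -
    have "a * t \<le> y t \<bullet> y t"
      using solves_linear_ode_norm_tangent[OF sym y, of t] inner_ge_zero[of "y 0"] unfolding a_def by linarith
    also have "\<dots> \<le> q t / c"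
      using c by (simp add: q_def pos_le_divide_eq mult.commute)
    finally show ?thesis
      by (simp add: that)
  qed
  have "a \<le> 0"
    by (rule nonpos_if_multiples_bounded[of _ "q 0 / c"]) (use bound[OF q_nat(1)] in \<open>simp add: mult.commute\<close>)
  moreover have "- a \<le> 0"
    by (rule nonpos_if_multiples_bounded[of _ "q 0 / c"]) (use bound[OF q_nat(2)] in \<open>simp add: mult.commute\<close>)
  ultimately show ?thesis
    by (simp add: a_def)
qed

lemma symmetric_matrix_eq_0:
  fixes A :: "real ^ 'n ^ 'n"
  assumes sym: "transpose A = A" and 0: "\<And>v. v \<bullet> (A *v v) = 0"
  shows "A = 0"
proof -
  have "A *v w = 0" for w
  proof -
    let ?v = "A *v w"
    have "w \<bullet> (A *v ?v) = ?v \<bullet> ?v"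
      by (rule symmetric_matrix_inner[OF sym, symmetric])
    then have "(?v + w) \<bullet> (A *v (?v + w)) = 2 * (?v \<bullet> (A *v w)) + ?v \<bullet> (A *v ?v) + w \<bullet> (A *v w)"
      by (simp add: matrix_vector_right_distrib inner_add_left inner_add_right)
    then show ?thesis
      using 0 by simp
  qed
  then show ?thesis
    by (simp add: matrix_eq)
qed

section \<open>Uniqueness of the potential and its divergence\<close>

text \<open>The logarithm of the moment generating function of \<open>\<phi> 1\<close> under \<open>N(m0, S)\<close>, evaluated at
  \<open>y 0\<close>, must equal that of \<open>N(m1, S)\<close>. Evaluating also at \<open>- y 0\<close> separates the linear part (the means) from
  the quadratic part (the covariances).\<close>

lemma gradient_flow_gaussian_cumulants:
  fixes A S :: "real ^ 'n ^ 'n"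
  assumes S: "pos_def S" and sym: "transpose A = A"
    and flow: "\<And>x t. ((\<lambda>s. \<phi> s x) has_vector_derivative (A *v \<phi> t x + b)) (at t)"
    and init: "\<And>x. \<phi> 0 x = x"
    and push: "pushes_forward (\<phi> 1) (gaussian m0 S) (gaussian m1 S)"
    and y: "solves_linear_ode A y"
  shows "y 0 \<bullet> \<phi> 1 m0 = y 0 \<bullet> m1" "y 1 \<bullet> (S *v y 1) = y 0 \<bullet> (S *v y 0)"
proof -
  have eq: "y 0 \<bullet> m1 + y 0 \<bullet> (S *v y 0) / 2 = y 0 \<bullet> \<phi> 1 m0 + y 1 \<bullet> (S *v y 1) / 2"
    if y: "solves_linear_ode A y" for y
  proof -
    have [measurable]: "\<phi> 1 \<in> borel_measurable borel"
      using push measurable_cong_sets[OF sets_gaussian[of m0 S] sets_gaussian[of m1 S]]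
      by (simp add: pushes_forward_def)
    \<comment> \<open>The difference of two trajectories of the affine flow solves the linear equation.\<close>
    have affine: "y 0 \<bullet> \<phi> 1 x = (y 0 \<bullet> \<phi> 1 m0 - y 1 \<bullet> m0) + y 1 \<bullet> x" for x
    proof -
      have "solves_linear_ode A (\<lambda>t. \<phi> t x - \<phi> t m0)"
        unfolding solves_linear_ode_def
        by (auto intro!: derivative_eq_intros flow simp: matrix_vector_mult_diff_distrib)
      from solves_linear_ode_pairing[OF sym y this] show ?thesis
        by (simp add: init inner_diff_left inner_diff_right inner_commute)
    qed
    have "ennreal (exp (y 0 \<bullet> m1 + y 0 \<bullet> (S *v y 0) / 2))
        = (\<integral>\<^sup>+x. ennreal (exp (y 0 \<bullet> x)) \<partial>distr (gaussian m0 S) (gaussian m1 S) (\<phi> 1))"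
      using push by (simp add: gaussian_moment_generating_function[OF S] pushes_forward_def)
    also have "\<dots> = (\<integral>\<^sup>+x. ennreal (exp (y 0 \<bullet> \<phi> 1 x)) \<partial>gaussian m0 S)"
      by (simp add: nn_integral_distr)
    also have "\<dots> = (\<integral>\<^sup>+x. ennreal (exp (y 0 \<bullet> \<phi> 1 m0 - y 1 \<bullet> m0)) * ennreal (exp (y 1 \<bullet> x)) \<partial>gaussian m0 S)"
      by (intro nn_integral_cong, subst affine) (simp add: exp_add ennreal_mult)
    also have "\<dots> = ennreal (exp (y 0 \<bullet> \<phi> 1 m0 - y 1 \<bullet> m0)) * ennreal (exp (y 1 \<bullet> m0 + y 1 \<bullet> (S *v y 1) / 2))"
      by (simp add: nn_integral_cmult gaussian_moment_generating_function[OF S])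
    also have "\<dots> = ennreal (exp (y 0 \<bullet> \<phi> 1 m0 + y 1 \<bullet> (S *v y 1) / 2))"
      by (simp add: ennreal_mult[symmetric] exp_add[symmetric])
    finally show ?thesis
      by simp
  qed
  have "- (y 0 \<bullet> m1) + y 0 \<bullet> (S *v y 0) / 2 = - (y 0 \<bullet> \<phi> 1 m0) + y 1 \<bullet> (S *v y 1) / 2"
    using eq[OF solves_linear_ode_uminus[OF y]] by (simp add: linear_neg[OF matrix_vector_mul_linear])
  with eq[OF y] show "y 0 \<bullet> \<phi> 1 m0 = y 0 \<bullet> m1" "y 1 \<bullet> (S *v y 1) = y 0 \<bullet> (S *v y 0)"
    by simp_all
qed

lemma is_wkl_potential_gaussian_same_covariance:
  fixes S :: "real ^ 'n ^ 'n"
  assumes S: "pos_def S"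
  shows "is_wkl_potential (gaussian m0 S) (gaussian m1 S) f \<longleftrightarrow> f = (\<lambda>x. (m1 - m0) \<bullet> x)"
proof
  assume "is_wkl_potential (gaussian m0 S) (gaussian m1 S) f"
  then obtain A b \<phi> where sym: "transpose A = A" and f: "f = (\<lambda>x. 1 / 2 * (x \<bullet> (A *v x)) + b \<bullet> x)"
    and \<phi>: "is_gradient_flow f \<phi>" and push: "pushes_forward (\<phi> 1) (gaussian m0 S) (gaussian m1 S)"
    unfolding is_wkl_potential_def quadratic_function_def by blast
  have init: "\<phi> 0 x = x" and flow: "((\<lambda>s. \<phi> s x) has_vector_derivative (A *v \<phi> t x + b)) (at t)" for x t
    using \<phi> unfolding f is_gradient_flow_quadratic_iff[OF sym] by auto
  note cumulants = gradient_flow_gaussian_cumulants[OF S sym flow init push]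
  have sol: "solves_linear_ode A (\<lambda>t. \<phi> t v - \<phi> t 0)" for v
    unfolding solves_linear_ode_def
    by (auto intro!: derivative_eq_intros flow simp: matrix_vector_mult_diff_distrib)
  \<comment> \<open>The trajectories from \<open>v\<close> and from 0 differ by a solution with initial value \<open>v\<close>.\<close>
  have "v \<bullet> (A *v v) = 0" for v
    using linear_ode_invariant_form_imp_stationary[OF sym S cumulants(2) sol[of v]] by (simp add: init)
  then have "A = 0"
    by (rule symmetric_matrix_eq_0[OF sym])
  then have f': "f = (\<lambda>x. b \<bullet> x)"
    by (simp add: f)
  then have "\<phi> 1 m0 = m0 + b"
    using \<phi> by (simp add: is_gradient_flow_linear_iff)
  moreover have "v \<bullet> \<phi> 1 m0 = v \<bullet> m1" for v
    using cumulants(1)[OF sol[of v]] by (simp add: init)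
  then have "\<phi> 1 m0 = m1"
    by (metis vector_eq_ldot)
  ultimately show "f = (\<lambda>x. (m1 - m0) \<bullet> x)"
    by (simp add: f')
next
  assume f: "f = (\<lambda>x. (m1 - m0) \<bullet> x)"
  have "quadratic_function f"
    unfolding quadratic_function_def f
    by (intro exI[of _ "0 :: real ^ 'n ^ 'n"] exI[of _ "m1 - m0"]) simp
  moreover have "is_gradient_flow f (\<lambda>t x. x + t *\<^sub>R (m1 - m0))"
    by (simp add: f is_gradient_flow_linear_iff)
  moreover have "pushes_forward (\<lambda>x. x + 1 *\<^sub>R (m1 - m0)) (gaussian m0 S) (gaussian m1 S)"
    using gaussian_translate[of "m1 - m0" m0 S] by simp
  ultimately show "is_wkl_potential (gaussian m0 S) (gaussian m1 S) f"
    unfolding is_wkl_potential_def by blast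
qed

theorem mainTheorem6:
  fixes m0 m1 :: "real ^ 'n" and S :: "real ^ 'n ^ 'n"
  assumes "pos_def S"
  shows "D_WKL (gaussian m0 S) (gaussian m1 S) = 1 / 2 * (norm (m1 - m0))\<^sup>2"
proof -
  define b where "b = m1 - m0"
  have potential: "wkl_potential (gaussian m0 S) (gaussian m1 S) = (\<lambda>x. b \<bullet> x)"
    unfolding wkl_potential_def is_wkl_potential_gaussian_same_covariance[OF assms] b_def by simp
  have flow: "gradient_flow (\<lambda>x. b \<bullet> x) = (\<lambda>t x. x + t *\<^sub>R b)"
    unfolding gradient_flow_def is_gradient_flow_linear_iff by simp
  have inner_integral: "(LINT t:{0..1}|lborel. b \<bullet> (x + 1 *\<^sub>R b) - b \<bullet> (x + t *\<^sub>R b)) = 1 / 2 * (b \<bullet> b)" for x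
  proof -
    have "(LINT t|lborel. indicator {0..1} t *\<^sub>R ((1 - t) * (b \<bullet> b)))
        = (1 - 1\<^sup>2 / 2) * (b \<bullet> b) - (0 - 0\<^sup>2 / 2) * (b \<bullet> b)"
      by (rule integral_FTC_atLeastAtMost) (auto intro!: derivative_eq_intros continuous_intros
          simp: has_real_derivative_iff_has_vector_derivative[symmetric])
    then show ?thesis
      by (simp add: set_lebesgue_integral_def inner_add_right algebra_simps)
  qed
  have "emeasure (gaussian m0 S) UNIV = 1"
    using gaussian_moment_generating_function[OF assms, where v=0 and m=m0] by simp
  then have "measure (gaussian m0 S) UNIV = 1"
    by (simp add: measure_def)
  then show ?thesis
    unfolding D_WKL_def potential Let_def flow inner_integral
    by (simp add: b_def power2_norm_eq_inner)
qed

end
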